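(* Let $C_i, D_i$, $i\in I$, be categories and let $\delta_i\colon C_i\to D_i$, $i\in I$, be frank functors. Let $K\subseteq I$ be finite, and assume that $\hom(a,b)$ is finite for all $a,b\in\mathrm{ob}(C_i)$ with $i\in K$. If $\delta_i$ fulfills (P) at $a_i\in\mathrm{ob}(C_i)$ for each $i\in K$, then the functor $\otimes_I\delta_i\colon\bigotimes_I C_i\to\bigotimes_I D_i$ fulfills (P) at the object $(a_i)_{i\in K}$ of $\bigotimes_I C_i$.
   Context: For a category $C$, $\mathrm{ob}(C)$ is the class of objects and $\hom(a,b)$ is the class of morphisms of $C$ from $a$ to $b$; composition is written $g\cdot f$ (for $f\in\hom(a,b)$, $g\in\hom(b,c)$, $g\cdot f\in\hom(a,c)$). $\mathbb N$ includes $0$. For $r\in\mathbb N$, an $r$-coloring of a set $X$ is a function on $X$ with at most $r$ values. Condition (P). Let $\delta$ be a functor defined on a category $C$ and let $a,b\in \mathrm{ob}(C)$. The functor $\delta$ fulfills (P) at $a,b$ if for each $r\in\mathbb N$ there exists $c\in \mathrm{ob}(C)$ such that for each $r$-coloring $\chi$ of $\hom(a,c)$ there exists $g\in\hom(b,c)$ such that for all $f_1,f_2\in\hom(a,b)$: $\delta(f_1)=\delta(f_2)$ implies $\chi(g\cdot f_1)=\chi(g\cdot f_2)$. The functor $\delta$ fulfills (P) at $a\in\mathrm{ob}(C)$ if it fulfills (P) at $a,b$ for all $b\in \mathrm{ob}(C)$. Frank functors. A functor $\delta\colon C\to D$ is frank if for all $a\in\mathrm{ob}(C)$ and $b'\in\mathrm{ob}(D)$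 there exists $b\in\mathrm{ob}(C)$ with $\delta(b)=b'$ (equality of objects) and $\delta(\hom(a,b))=\hom(\delta(a),\delta(b))$. Finitely supported products. For a family of categories $C_i$, $i\in I$, the category $\bigotimes_I C_i$ has as objects the families $(c_i)_{i\in K}$, where $K\subseteq I$ is finite and $c_i\in\mathrm{ob}(C_i)$ for $i\in K$. Its morphisms are the families $(f_i)_{i\in K}$, where $K\subseteq I$ is finite and $f_i\in\hom(c_i,d_i)$ with $c_i,d_i\in\mathrm{ob}(C_i)$; such a family is a morphism from $(c_i)_{i\in K}$ to $(d_i)_{i\in K}$ (so there are no morphisms between objects with different index sets). Composition is coordinatewise. Given functors $\delta_i\colon C_i\to D_i$, the functor $\otimes_I\delta_i\colon\bigotimes_I C_i\to\bigotimes_I D_i$ is defined by $(\otimes_I\delta_i)((c_i)_{i\in K})=(\delta_i(c_i))_{i\in K}$ and $(\otimes_I\delta_i)((f_i)_{i\in K})=(\delta_i(f_i))_{i\in K}$. *)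

theory Defs
  imports Main
begin

text \<open>
  The arrows of a category carry their source and target, so the hom-classes are pairwise disjoint.
\<close>

record ('o, 'm) category =
  ob :: "'o set"
  arr :: "'m set"
  src :: "'m \<Rightarrow> 'o"
  tgt :: "'m \<Rightarrow> 'o"
  ident :: "'o \<Rightarrow> 'm"
  compos :: "'m \<Rightarrow> 'm \<Rightarrow> 'm"

definition hom :: "('o, 'm) category \<Rightarrow> 'o \<Rightarrow> 'o \<Rightarrow> 'm set" where
  "hom C a b = {f \<in> arr C. src C f = a \<and> tgt C f = b}"

text \<open>\<open>compos C g f\<close> is first \<open>f\<close>, then \<open>g\<close>.\<close>

locale category =
  fixes C :: "('o, 'm) category"
  assumes src_ob: "f \<in> arr C \<Longrightarrow> src C f \<in> ob C"
    and tgt_ob: "f \<in> arr C \<Longrightarrow> tgt C f \<in> ob C"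
    and ident_hom: "a \<in> ob C \<Longrightarrow> ident C a \<in> hom C a a"
    and comp_hom: "f \<in> hom C a b \<Longrightarrow> g \<in> hom C b c \<Longrightarrow> compos C g f \<in> hom C a c"
    and comp_ident_right: "f \<in> hom C a b \<Longrightarrow> compos C f (ident C a) = f"
    and comp_ident_left: "f \<in> hom C a b \<Longrightarrow> compos C (ident C b) f = f"
    and comp_assoc: "f \<in> hom C a b \<Longrightarrow> g \<in> hom C b c \<Longrightarrow> h \<in> hom C c d
      \<Longrightarrow> compos C h (compos C g f) = compos C (compos C h g) f"

record ('o, 'm, 'p, 'n) functor_data =
  obj_map :: "'o \<Rightarrow> 'p"
  arr_map :: "'m \<Rightarrow> 'n"

locale cat_functor = source: category C + target: category D
  for C :: "('o, 'm) category" and D :: "('p, 'n) category" +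
  fixes \<delta> :: "('o, 'm, 'p, 'n) functor_data"
  assumes obj_map_ob: "a \<in> ob C \<Longrightarrow> obj_map \<delta> a \<in> ob D"
    and arr_map_hom: "f \<in> hom C a b \<Longrightarrow> arr_map \<delta> f \<in> hom D (obj_map \<delta> a) (obj_map \<delta> b)"
    and arr_map_ident: "a \<in> ob C \<Longrightarrow> arr_map \<delta> (ident C a) = ident D (obj_map \<delta> a)"
    and arr_map_comp: "f \<in> hom C a b \<Longrightarrow> g \<in> hom C b c
      \<Longrightarrow> arr_map \<delta> (compos C g f) = compos D (arr_map \<delta> g) (arr_map \<delta> f)"

locale frank_functor = cat_functor C D \<delta>
  for C :: "('o, 'm) category" and D :: "('p, 'n) category"
    and \<delta> :: "('o, 'm, 'p, 'n) functor_data" +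
  assumes frank: "a \<in> ob C \<Longrightarrow> b' \<in> ob D \<Longrightarrow>
    \<exists>b \<in> ob C. obj_map \<delta> b = b' \<and> arr_map \<delta> ` hom C a b = hom D (obj_map \<delta> a) (obj_map \<delta> b)"

text \<open>
  A coloring has finitely many values, so nothing is lost by using natural numbers as colors.
  Finiteness of the image has to be demanded separately, as \<open>card\<close> of an infinite set is \<open>0\<close>.
\<close>

definition coloring :: "nat \<Rightarrow> 'x set \<Rightarrow> ('x \<Rightarrow> nat) \<Rightarrow> bool" where
  "coloring r X \<chi> \<longleftrightarrow> finite (\<chi> ` X) \<and> card (\<chi> ` X) \<le> r"

definition fulfills_P_at2 ::
  "('o, 'm) category \<Rightarrow> ('o, 'm, 'p, 'n) functor_data \<Rightarrow> 'o \<Rightarrow> 'o \<Rightarrow> bool" where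
  "fulfills_P_at2 C \<delta> a b \<longleftrightarrow>
    (\<forall>r. \<exists>c \<in> ob C. \<forall>\<chi>. coloring r (hom C a c) \<chi> \<longrightarrow>
      (\<exists>g \<in> hom C b c. \<forall>f\<^sub>1 \<in> hom C a b. \<forall>f\<^sub>2 \<in> hom C a b.
        arr_map \<delta> f\<^sub>1 = arr_map \<delta> f\<^sub>2 \<longrightarrow> \<chi> (compos C g f\<^sub>1) = \<chi> (compos C g f\<^sub>2)))"

definition fulfills_P_at ::
  "('o, 'm) category \<Rightarrow> ('o, 'm, 'p, 'n) functor_data \<Rightarrow> 'o \<Rightarrow> bool" where
  "fulfills_P_at C \<delta> a \<longleftrightarrow> (\<forall>b \<in> ob C. fulfills_P_at2 C \<delta> a b)"

text \<open>
  A family indexed by a subset \<open>K\<close> of \<open>'i\<close> is a partial map with domain exactly \<open>K\<close>; thus families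
  with different index sets are different.
\<close>

definition family :: "'i set \<Rightarrow> ('i \<Rightarrow> 'a) \<Rightarrow> 'i \<rightharpoonup> 'a" where
  "family K x = (\<lambda>i. if i \<in> K then Some (x i) else None)"

definition finsupp_prod ::
  "'i set \<Rightarrow> ('i \<Rightarrow> ('o, 'm) category) \<Rightarrow> ('i \<rightharpoonup> 'o, 'i \<rightharpoonup> 'm) category" where
  "finsupp_prod I C = \<lparr>
    ob = {family K c | K c. K \<subseteq> I \<and> finite K \<and> (\<forall>i \<in> K. c i \<in> ob (C i))},
    arr = {family K f | K f. K \<subseteq> I \<and> finite K \<and> (\<forall>i \<in> K. f i \<in> arr (C i))},
    src = (\<lambda>f i. map_option (src (C i)) (f i)),
    tgt = (\<lambda>f i. map_option (tgt (C i)) (f i)),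
    ident = (\<lambda>c i. map_option (ident (C i)) (c i)),
    compos = (\<lambda>g f i. case (g i, f i) of (Some y, Some x) \<Rightarrow> Some (compos (C i) y x) | _ \<Rightarrow> None)\<rparr>"

definition prod_functor ::
  "('i \<Rightarrow> ('o, 'm, 'p, 'n) functor_data)
    \<Rightarrow> ('i \<rightharpoonup> 'o, 'i \<rightharpoonup> 'm, 'i \<rightharpoonup> 'p, 'i \<rightharpoonup> 'n) functor_data" where
  "prod_functor \<delta> = \<lparr>
    obj_map = (\<lambda>c i. map_option (obj_map (\<delta> i)) (c i)),
    arr_map = (\<lambda>f i. map_option (arr_map (\<delta> i)) (f i))\<rparr>"

lemma family_ob_finsupp_prod:
  assumes "K \<subseteq> I" "finite K" "\<And>i. i \<in> K \<Longrightarrow> c i \<in> ob (C i)"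
  shows "family K c \<in> ob (finsupp_prod I C)"
  using assms by (auto simp: finsupp_prod_def)

lemma dom_family [simp]: "dom (family K x) = K"
  by (auto simp: family_def split: if_splits)

lemma family_eq_iff:
  "family K x = family L y \<longleftrightarrow> K = L \<and> (\<forall>i \<in> K. x i = y i)"
  by (auto simp: family_def fun_eq_iff split: if_splits)

lemma hom_finsupp_prod:
  assumes "K \<subseteq> I" "finite K"
  shows "hom (finsupp_prod I C) (family K c) (family K d) =
    {family K f | f. \<forall>i \<in> K. f i \<in> hom (C i) (c i) (d i)}"
proof -
  have "src (finsupp_prod I C) (family L f) = family L (\<lambda>i. src (C i) (f i))"
    "tgt (finsupp_prod I C) (family L f) = family L (\<lambda>i. tgt (C i) (f i))" for L f
    by (auto simp: finsupp_prod_def family_def)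
  moreover have "arr (finsupp_prod I C) =
    {family L f | L f. L \<subseteq> I \<and> finite L \<and> (\<forall>i \<in> L. f i \<in> arr (C i))}"
    by (simp add: finsupp_prod_def)
  ultimately show ?thesis
    using assms by (auto simp: hom_def family_eq_iff) blast+
qed

lemma hom_finsupp_prod_empty:
  assumes "K \<noteq> L"
  shows "hom (finsupp_prod I C) (family K c) (family L d) = {}"
proof -
  have "dom f = dom (src (finsupp_prod I C) f)" "dom f = dom (tgt (finsupp_prod I C) f)" for f
    by (auto simp: finsupp_prod_def)
  then show ?thesis
    using assms unfolding hom_def by (metis (mono_tags, lifting) dom_family empty_Collect_eq)
qed

lemma in_hom_finsupp_prod_iff:
  "f \<in> hom (finsupp_prod I C) c d \<longleftrightarrow>
    dom f \<subseteq> I \<and> finite (dom f) \<and> dom c = dom f \<and> dom d = dom f \<and>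
    (\<forall>i \<in> dom f. the (f i) \<in> hom (C i) (the (c i)) (the (d i)))"
  (is "?l \<longleftrightarrow> ?r")
proof
  assume ?l
  then obtain K x where x: "f = family K x" "K \<subseteq> I" "finite K" "\<forall>i \<in> K. x i \<in> arr (C i)"
    and "c = (\<lambda>i. map_option (src (C i)) (f i))" "d = (\<lambda>i. map_option (tgt (C i)) (f i))"
    by (auto simp: hom_def finsupp_prod_def)
  then have "c = family K (\<lambda>i. src (C i) (x i))" "d = family K (\<lambda>i. tgt (C i) (x i))"
    by (auto simp: family_def)
  with x show ?r
    by (simp add: hom_def) (simp add: family_def)
next
  assume r: ?r
  have "f = family (dom f) (\<lambda>i. the (f i))"
    by (auto simp: family_def fun_eq_iff)
  moreover have "\<forall>i \<in> dom f. the (f i) \<in> arr (C i)"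
    using r by (auto simp: hom_def)
  ultimately have "f \<in> arr (finsupp_prod I C)"
    using r unfolding finsupp_prod_def category.simps by blast
  moreover have "map_option (src (C i)) (f i) = c i" "map_option (tgt (C i)) (f i) = d i" for i
  proof -
    have "c i = None \<longleftrightarrow> f i = None" "d i = None \<longleftrightarrow> f i = None"
      using r by blast+
    moreover have "f i \<noteq> None \<Longrightarrow> the (f i) \<in> hom (C i) (the (c i)) (the (d i))"
      using r by blast
    ultimately show "map_option (src (C i)) (f i) = c i" "map_option (tgt (C i)) (f i) = d i"
      by (cases "f i"; cases "c i"; cases "d i"; simp add: hom_def)+
  qed
  ultimately show ?l
    by (auto simp: hom_def finsupp_prod_def)
qed

lemma in_ob_finsupp_prod_iff:
  "c \<in> ob (finsupp_prod I C) \<longleftrightarrow>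
    dom c \<subseteq> I \<and> finite (dom c) \<and> (\<forall>i \<in> dom c. the (c i) \<in> ob (C i))"
  (is "?l \<longleftrightarrow> ?r")
proof
  assume ?l
  then obtain K x where "c = family K x" "K \<subseteq> I" "finite K" "\<forall>i \<in> K. x i \<in> ob (C i)"
    by (auto simp: finsupp_prod_def)
  then show ?r
    by simp (simp add: family_def)
next
  assume r: ?r
  have "c = family (dom c) (\<lambda>i. the (c i))"
    by (auto simp: family_def fun_eq_iff)
  then show ?l
    using r unfolding finsupp_prod_def category.simps by blast
qed

lemma compos_finsupp_prod:
  "compos (finsupp_prod I C) g f =
    (\<lambda>i. if i \<in> dom g \<inter> dom f then Some (compos (C i) (the (g i)) (the (f i))) else None)"
  by (auto simp: finsupp_prod_def fun_eq_iff split: option.splits)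

lemma ident_finsupp_prod:
  "ident (finsupp_prod I C) c = (\<lambda>i. map_option (ident (C i)) (c i))"
  by (simp add: finsupp_prod_def)

lemma category_finsupp_prod:
  assumes C: "\<And>i. i \<in> I \<Longrightarrow> category (C i)"
  shows "category (finsupp_prod I C)"
proof
  fix f assume "f \<in> arr (finsupp_prod I C)"
  then obtain c d where f: "f \<in> hom (finsupp_prod I C) c d"
    and [simp]: "src (finsupp_prod I C) f = c" "tgt (finsupp_prod I C) f = d"
    by (auto simp: hom_def)
  have "the (c i) \<in> ob (C i) \<and> the (d i) \<in> ob (C i)" if "i \<in> dom f" for i
  proof -
    have "category (C i)" "the (f i) \<in> hom (C i) (the (c i)) (the (d i))"
      using that f C[of i] by (auto simp: in_hom_finsupp_prod_iff)
    then show ?thesis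
      using category.src_ob category.tgt_ob by (fastforce simp: hom_def)
  qed
  then show "src (finsupp_prod I C) f \<in> ob (finsupp_prod I C)"
    "tgt (finsupp_prod I C) f \<in> ob (finsupp_prod I C)"
    using f by (auto simp: in_hom_finsupp_prod_iff in_ob_finsupp_prod_iff)
next
  fix c assume "c \<in> ob (finsupp_prod I C)"
  then show "ident (finsupp_prod I C) c \<in> hom (finsupp_prod I C) c c"
    using category.ident_hom[OF C]
    by (auto simp: in_ob_finsupp_prod_iff in_hom_finsupp_prod_iff ident_finsupp_prod
        dom_map_option subset_eq Ball_def domIff)
next
  fix f g a b c
  assume arrs: "f \<in> hom (finsupp_prod I C) a b" "g \<in> hom (finsupp_prod I C) b c"
  then have *: "dom f \<subseteq> I" "finite (dom f)" "dom g = dom f" "dom a = dom f" "dom c = dom f"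
    by (auto simp: in_hom_finsupp_prod_iff)
  have **: "the (f i) \<in> hom (C i) (the (a i)) (the (b i))"
      "the (g i) \<in> hom (C i) (the (b i)) (the (c i))" if "i \<in> dom f" for i
    using arrs that by (auto simp: in_hom_finsupp_prod_iff)
  have d: "dom (compos (finsupp_prod I C) g f) = dom f"
    using * by (auto simp: compos_finsupp_prod split: if_splits)
  have "the (compos (finsupp_prod I C) g f i) \<in> hom (C i) (the (a i)) (the (c i))"
    if "i \<in> dom f" for i
    using category.comp_hom[OF C **[OF that]] * that by (auto simp: compos_finsupp_prod)
  then show "compos (finsupp_prod I C) g f \<in> hom (finsupp_prod I C) a c"
    unfolding in_hom_finsupp_prod_iff d using * by simp
next
  fix f a b
  assume f: "f \<in> hom (finsupp_prod I C) a b"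
  show "compos (finsupp_prod I C) f (ident (finsupp_prod I C) a) = f"
  proof
    fix i
    show "compos (finsupp_prod I C) f (ident (finsupp_prod I C) a) i = f i"
    proof (cases "i \<in> dom f")
      case True
      then have "i \<in> I" "i \<in> dom a" "the (f i) \<in> hom (C i) (the (a i)) (the (b i))"
        using f by (auto simp: in_hom_finsupp_prod_iff)
      then show ?thesis
        using True category.comp_ident_right[OF C]
        by (auto simp: compos_finsupp_prod ident_finsupp_prod)
    next
      case False
      then show ?thesis
        by (simp add: compos_finsupp_prod domIff)
    qed
  qed
  show "compos (finsupp_prod I C) (ident (finsupp_prod I C) b) f = f"
  proof
    fix i
    show "compos (finsupp_prod I C) (ident (finsupp_prod I C) b) f i = f i"
    proof (cases "i \<in> dom f")
      case True
      then have "i \<in> I" "i \<in> dom b" "the (f i) \<in> hom (C i) (the (a i)) (the (b i))"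
        using f by (auto simp: in_hom_finsupp_prod_iff)
      then show ?thesis
        using True category.comp_ident_left[OF C]
        by (auto simp: compos_finsupp_prod ident_finsupp_prod)
    next
      case False
      then show ?thesis
        by (simp add: compos_finsupp_prod domIff)
    qed
  qed
next
  fix f g h a b c d
  assume arrs: "f \<in> hom (finsupp_prod I C) a b" "g \<in> hom (finsupp_prod I C) b c"
    "h \<in> hom (finsupp_prod I C) c d"
  then have *: "dom f \<subseteq> I" "dom g = dom f" "dom h = dom f"
    by (auto simp: in_hom_finsupp_prod_iff)
  have **: "the (f i) \<in> hom (C i) (the (a i)) (the (b i))"
      "the (g i) \<in> hom (C i) (the (b i)) (the (c i))"
      "the (h i) \<in> hom (C i) (the (c i)) (the (d i))" if "i \<in> dom f" for i
    using arrs that by (auto simp: in_hom_finsupp_prod_iff)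
  have d: "dom (compos (finsupp_prod I C) g f) = dom f" "dom (compos (finsupp_prod I C) h g) = dom f"
    using * by (auto simp: compos_finsupp_prod split: if_splits)
  have v: "compos (finsupp_prod I C) v u i = Some (compos (C i) (the (v i)) (the (u i)))"
    if "i \<in> dom f" "dom u = dom f" "dom v = dom f" for u v i
    using that by (simp add: compos_finsupp_prod)
  have n: "compos (finsupp_prod I C) v u i = None"
    if "i \<notin> dom f" "dom u = dom f" for u v i
    using that by (simp add: compos_finsupp_prod)
  show "compos (finsupp_prod I C) h (compos (finsupp_prod I C) g f) =
    compos (finsupp_prod I C) (compos (finsupp_prod I C) h g) f"
  proof
    fix i
    show "compos (finsupp_prod I C) h (compos (finsupp_prod I C) g f) i =
      compos (finsupp_prod I C) (compos (finsupp_prod I C) h g) f i"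
    proof (cases "i \<in> dom f")
      case True
      then show ?thesis
        using category.comp_assoc[OF C **[OF True]] * by (auto simp: v d)
    next
      case False
      then show ?thesis
        by (simp add: n d)
    qed
  qed
qed

lemma cat_functor_prod_functor:
  assumes F: "\<And>i. i \<in> I \<Longrightarrow> cat_functor (C i) (D i) (\<delta> i)"
  shows "cat_functor (finsupp_prod I C) (finsupp_prod I D) (prod_functor \<delta>)"
proof -
  have "category (finsupp_prod I C)" "category (finsupp_prod I D)"
    using F by (auto intro!: category_finsupp_prod simp: cat_functor_def)
  moreover have "cat_functor_axioms (finsupp_prod I C) (finsupp_prod I D) (prod_functor \<delta>)"
  proof
    fix c assume c: "c \<in> ob (finsupp_prod I C)"
    then show "obj_map (prod_functor \<delta>) c \<in> ob (finsupp_prod I D)"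
      using cat_functor.obj_map_ob[OF F]
      by (auto simp: in_ob_finsupp_prod_iff prod_functor_def dom_map_option subset_eq Ball_def domIff)
    show "arr_map (prod_functor \<delta>) (ident (finsupp_prod I C) c) =
      ident (finsupp_prod I D) (obj_map (prod_functor \<delta>) c)"
    proof
      fix i
      show "arr_map (prod_functor \<delta>) (ident (finsupp_prod I C) c) i =
        ident (finsupp_prod I D) (obj_map (prod_functor \<delta>) c) i"
        using c cat_functor.arr_map_ident[OF F, of i "the (c i)"]
        by (cases "c i")
          (auto simp: in_ob_finsupp_prod_iff prod_functor_def ident_finsupp_prod subset_eq Ball_def domIff)
    qed
  next
    fix f a b assume f: "f \<in> hom (finsupp_prod I C) a b"
    have d: "dom (obj_map (prod_functor \<delta>) x) = dom x" "dom (arr_map (prod_functor \<delta>) g) = dom g"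
      for x g by (auto simp: prod_functor_def)
    have "the (arr_map (prod_functor \<delta>) f i) \<in> hom (D i) (the (obj_map (prod_functor \<delta>) a i))
      (the (obj_map (prod_functor \<delta>) b i))" if "i \<in> dom f" for i
    proof -
      have "i \<in> I" "i \<in> dom a" "i \<in> dom b" "the (f i) \<in> hom (C i) (the (a i)) (the (b i))"
        using f that by (auto simp: in_hom_finsupp_prod_iff)
      then show ?thesis
        using cat_functor.arr_map_hom[OF F, of i "the (f i)" "the (a i)" "the (b i)"] that
        by (auto simp: prod_functor_def)
    qed
    then show "arr_map (prod_functor \<delta>) f
      \<in> hom (finsupp_prod I D) (obj_map (prod_functor \<delta>) a) (obj_map (prod_functor \<delta>) b)"
      using f by (simp add: in_hom_finsupp_prod_iff d)
  next
    fix f g a b c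
    assume fg: "f \<in> hom (finsupp_prod I C) a b" "g \<in> hom (finsupp_prod I C) b c"
    show "arr_map (prod_functor \<delta>) (compos (finsupp_prod I C) g f) =
      compos (finsupp_prod I D) (arr_map (prod_functor \<delta>) g) (arr_map (prod_functor \<delta>) f)"
    proof
      fix i
      have "arr_map (\<delta> i) (compos (C i) (the (g i)) (the (f i))) =
        compos (D i) (arr_map (\<delta> i) (the (g i))) (arr_map (\<delta> i) (the (f i)))"
        if "i \<in> dom f"
        using that fg cat_functor.arr_map_comp[OF F, of i "the (f i)" "the (a i)" "the (b i)"
          "the (g i)" "the (c i)"]
        by (auto simp: in_hom_finsupp_prod_iff)
      then show "arr_map (prod_functor \<delta>) (compos (finsupp_prod I C) g f) i =
        compos (finsupp_prod I D) (arr_map (prod_functor \<delta>) g) (arr_map (prod_functor \<delta>) f) i"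
        by (auto simp: prod_functor_def compos_finsupp_prod)
    qed
  qed
  ultimately show ?thesis
    by (simp add: cat_functor_def)
qed

end

theory Submission
  imports Defs "HOL-Library.FuncSet"
begin

text \<open>
  Induction on \<open>K\<close>; the step is a product argument for two factors. Given \<open>b\<^sub>1, b\<^sub>2\<close> and \<open>r\<close>, choose
  \<open>c\<^sub>2\<close> for \<open>r\<close> to the power of the size of \<open>hom(a\<^sub>1, b\<^sub>1)\<close> many colors, and then \<open>c\<^sub>1\<close> for \<open>r\<close> to the
  power of the size of \<open>hom(a\<^sub>2, c\<^sub>2)\<close> many colors. For a coloring \<open>\<chi>\<close>, first find \<open>g\<^sub>1\<close> that is good
  for all the colorings \<open>\<chi>(\<cdot>, h)\<close> with \<open>h\<close> in \<open>hom(a\<^sub>2, c\<^sub>2)\<close>, and then \<open>g\<^sub>2\<close> that is good for all the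
  colorings \<open>\<chi>(g\<^sub>1 f, \<cdot>)\<close> with \<open>f\<close> in \<open>hom(a\<^sub>1, b\<^sub>1)\<close>.
\<close>

section \<open>Property (P) in one category\<close>

text \<open>Take \<open>c = b\<close> and the identity of \<open>b\<close> as \<open>g\<close>. This
  covers empty hom-sets as well, where (P) still asks for some arrow out of
  \<open>b\<close>.\<close>

lemma (in category) fulfills_P_at2_if_subsingleton:
  assumes "b \<in> ob C" and "\<And>f\<^sub>1 f\<^sub>2. f\<^sub>1 \<in> hom C a b \<Longrightarrow> f\<^sub>2 \<in> hom C a b \<Longrightarrow> f\<^sub>1 = f\<^sub>2"
  shows "fulfills_P_at2 C \<delta> a b"
  unfolding fulfills_P_at2_def using assms ident_hom by metis

text \<open>Colorings indexed by \<open>X\<close> with values in a common palette \<open>S\<close>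
  bundle into one coloring whose colors are functions from \<open>X\<close> to \<open>S\<close>, at
  most \<open>r ^ card X\<close> of them. The object \<open>c\<close> depends on \<open>r\<close>
  and \<open>X\<close> but not on \<open>S\<close> or the colorings, so it can be fixed before they
  are known.\<close>

lemma (in category) fulfills_P_at2_simultaneous:
  fixes X :: "'x set" and \<delta> :: "('o, 'm, 'p, 'n) functor_data" and a b :: 'o and r :: nat
  assumes P: "fulfills_P_at2 C \<delta> a b" and X: "finite X"
  shows "\<exists>c \<in> ob C. \<forall>(\<chi> :: 'x \<Rightarrow> 'm \<Rightarrow> nat) S. finite S \<longrightarrow> card S \<le> r \<longrightarrow>
      (\<forall>x \<in> X. \<forall>f \<in> hom C a c. \<chi> x f \<in> S) \<longrightarrow>
      (\<exists>g \<in> hom C b c. \<forall>f\<^sub>1 \<in> hom C a b. \<forall>f\<^sub>2 \<in> hom C a b.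
        arr_map \<delta> f\<^sub>1 = arr_map \<delta> f\<^sub>2 \<longrightarrow>
        (\<forall>x \<in> X. \<chi> x (compos C g f\<^sub>1) = \<chi> x (compos C g f\<^sub>2)))"
proof -
  obtain c where c: "c \<in> ob C"
    and mono: "\<And>\<chi>. coloring (r ^ card X) (hom C a c) \<chi> \<Longrightarrow>
      \<exists>g \<in> hom C b c. \<forall>f\<^sub>1 \<in> hom C a b. \<forall>f\<^sub>2 \<in> hom C a b.
        arr_map \<delta> f\<^sub>1 = arr_map \<delta> f\<^sub>2 \<longrightarrow> \<chi> (compos C g f\<^sub>1) = \<chi> (compos C g f\<^sub>2)"
    using P unfolding fulfills_P_at2_def by blast
  show ?thesis
  proof (intro bexI[OF _ c] allI impI)
    fix \<chi> :: "'x \<Rightarrow> 'm \<Rightarrow> nat" and S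
    assume S: "finite S" "card S \<le> r" and \<chi>: "\<forall>x \<in> X. \<forall>f \<in> hom C a c. \<chi> x f \<in> S"
    \<comment> \<open>The bundled color of \<open>f\<close>; restricting it to \<open>X\<close>
      places it in the finite set of extensional functions.\<close>
    define \<psi> where "\<psi> f = (\<lambda>x\<in>X. \<chi> x f)" for f
    have fin: "finite (X \<rightarrow>\<^sub>E S)"
      using X S by (simp add: finite_PiE)
    \<comment> \<open>Colors have to be natural numbers, so the functions are encoded by
      \<open>e\<close>.\<close>
    then obtain e :: "('x \<Rightarrow> nat) \<Rightarrow> nat" where e: "inj_on e (X \<rightarrow>\<^sub>E S)"
      using finite_imp_inj_to_nat_seg by blast
    have sub: "\<psi> ` hom C a c \<subseteq> X \<rightarrow>\<^sub>E S"
      using \<chi> by (auto simp: \<psi>_def)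
    have "card (e ` \<psi> ` hom C a c) \<le> card (\<psi> ` hom C a c)"
      using finite_subset[OF sub fin] by (rule card_image_le)
    also have "\<dots> \<le> card (X \<rightarrow>\<^sub>E S)"
      using fin sub by (rule card_mono)
    also have "\<dots> \<le> r ^ card X"
      using S X by (simp add: card_PiE power_mono)
    finally have "coloring (r ^ card X) (hom C a c) (e \<circ> \<psi>)"
      using finite_subset[OF sub fin] unfolding coloring_def image_comp[symmetric] by simp
    from mono[OF this] obtain g where g: "g \<in> hom C b c"
      and eq: "\<And>f\<^sub>1 f\<^sub>2. f\<^sub>1 \<in> hom C a b \<Longrightarrow> f\<^sub>2 \<in> hom C a b \<Longrightarrow>
        arr_map \<delta> f\<^sub>1 = arr_map \<delta> f\<^sub>2 \<Longrightarrow> e (\<psi> (compos C g f\<^sub>1)) = e (\<psi> (compos C g f\<^sub>2))"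
      by auto
    have "\<chi> x (compos C g f\<^sub>1) = \<chi> x (compos C g f\<^sub>2)"
      if "f\<^sub>1 \<in> hom C a b" "f\<^sub>2 \<in> hom C a b" "arr_map \<delta> f\<^sub>1 = arr_map \<delta> f\<^sub>2" "x \<in> X" for f\<^sub>1 f\<^sub>2 x
    proof -
      have "\<psi> (compos C g f) \<in> X \<rightarrow>\<^sub>E S" if "f \<in> hom C a b" for f
        using sub comp_hom[OF that g] by blast
      then have "\<psi> (compos C g f\<^sub>1) = \<psi> (compos C g f\<^sub>2)"
        using eq[OF that(1-3)] that(1,2) by (intro inj_onD[OF e])
      then show ?thesis
        using that(4) unfolding \<psi>_def by (metis restrict_apply')
    qed
    with g show "\<exists>g \<in> hom C b c. \<forall>f\<^sub>1 \<in> hom C a b. \<forall>f\<^sub>2 \<in> hom C a b.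
        arr_map \<delta> f\<^sub>1 = arr_map \<delta> f\<^sub>2 \<longrightarrow>
        (\<forall>x \<in> X. \<chi> x (compos C g f\<^sub>1) = \<chi> x (compos C g f\<^sub>2))"
      by blast
  qed
qed

section \<open>Splitting one coordinate off the finitely supported product\<close>

lemma dom_eq_if_in_hom_finsupp_prod:
  "f \<in> hom (finsupp_prod I C) c d \<Longrightarrow> dom c = dom f \<and> dom d = dom f"
  by (simp add: in_hom_finsupp_prod_iff)

lemma upd_in_hom_finsupp_prod:
  assumes "k \<in> I" "f \<in> hom (finsupp_prod I C) u v" "\<phi> \<in> hom (C k) x y"
  shows "f(k \<mapsto> \<phi>) \<in> hom (finsupp_prod I C) (u(k \<mapsto> x)) (v(k \<mapsto> y))"
  using assms by (auto simp: in_hom_finsupp_prod_iff)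

text \<open>Converse of \<open>upd_in_hom_finsupp_prod\<close>: together they identify the morphisms
  between the extended objects with pairs of morphisms. Since \<open>k\<close> lies outside both old
  index sets, deleting it from \<open>f\<close> leaves a family with exactly the old index
  set.\<close>

lemma in_hom_finsupp_prod_updE:
  assumes f: "f \<in> hom (finsupp_prod I C) (u(k \<mapsto> x)) (v(k \<mapsto> y))" and k: "k \<notin> dom u" "k \<notin> dom v"
  obtains f' \<phi> where "f = f'(k \<mapsto> \<phi>)" "f' \<in> hom (finsupp_prod I C) u v" "\<phi> \<in> hom (C k) x y"
proof
  have dom: "insert k (dom u) = dom f" "insert k (dom v) = dom f" "dom f \<subseteq> I" "finite (dom f)"
    and h: "\<And>i. i \<in> dom f \<Longrightarrow> the (f i) \<in> hom (C i) (the ((u(k \<mapsto> x)) i)) (the ((v(k \<mapsto> y)) i))"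
    using f unfolding in_hom_finsupp_prod_iff by auto
  show "f = (f(k := None))(k \<mapsto> the (f k))"
  proof -
    have "k \<in> dom f"
      using dom(1) by blast
    then show ?thesis
      by (auto simp: fun_eq_iff)
  qed
  show "the (f k) \<in> hom (C k) x y"
    using h[of k] dom by auto
  have d: "dom (f(k := None)) = dom f - {k}"
    by auto
  have "the ((f(k := None)) i) \<in> hom (C i) (the (u i)) (the (v i))" if "i \<in> dom f - {k}" for i
    using h[of i] that by auto
  then show "f(k := None) \<in> hom (finsupp_prod I C) u v"
    unfolding in_hom_finsupp_prod_iff d using dom k by auto
qed

lemma compos_finsupp_prod_upd:
  "compos (finsupp_prod I C) (g(k \<mapsto> \<gamma>)) (f(k \<mapsto> \<phi>)) =
    (compos (finsupp_prod I C) g f)(k \<mapsto> compos (C k) \<gamma> \<phi>)"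
  by (auto simp: compos_finsupp_prod)

lemma arr_map_prod_functor_upd:
  "arr_map (prod_functor \<delta>) (f(k \<mapsto> \<phi>)) = (arr_map (prod_functor \<delta>) f)(k \<mapsto> arr_map (\<delta> k) \<phi>)"
  by (auto simp: prod_functor_def)

lemma dom_arr_map_prod_functor [simp]: "dom (arr_map (prod_functor \<delta>) f) = dom f"
  by (auto simp: prod_functor_def)

text \<open>Used to split an equality of images under the product functor into one equality per
  factor.\<close>

lemma map_upd_eq_iff:
  "k \<notin> dom m \<Longrightarrow> k \<notin> dom n \<Longrightarrow> m(k \<mapsto> x) = n(k \<mapsto> y) \<longleftrightarrow> m = n \<and> x = y"
  by (metis domIff fun_upd_triv fun_upd_upd map_upd_eqD1)

text \<open>For finite \<open>dom u\<close>, a morphism is a partial map with a fixed finite domain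
  and values in a finite union of hom-sets. For infinite \<open>dom u\<close> there are no morphisms
  at all.\<close>

lemma finite_hom_finsupp_prod:
  assumes "\<And>i. i \<in> dom u \<Longrightarrow> finite (hom (C i) (the (u i)) (the (v i)))"
  shows "finite (hom (finsupp_prod I C) u v)"
proof (cases "finite (dom u)")
  case True
  let ?B = "\<Union>i \<in> dom u. hom (C i) (the (u i)) (the (v i))"
  have "hom (finsupp_prod I C) u v \<subseteq> {m. dom m = dom u \<and> ran m \<subseteq> ?B}"
  proof
    fix f assume f: "f \<in> hom (finsupp_prod I C) u v"
    have "y \<in> ?B" if "f i = Some y" for i y
    proof (rule UN_I[of i])
      show "i \<in> dom u" "y \<in> hom (C i) (the (u i)) (the (v i))"
        using f that by (auto simp: in_hom_finsupp_prod_iff dest!: bspec[of _ _ i])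
    qed
    then show "f \<in> {m. dom m = dom u \<and> ran m \<subseteq> ?B}"
      using dom_eq_if_in_hom_finsupp_prod[OF f] by (auto simp: ran_def)
  qed
  moreover have "finite {m. dom m = dom u \<and> ran m \<subseteq> ?B}"
    using True assms by (intro finite_set_of_finite_maps) auto
  ultimately show ?thesis
    by (rule finite_subset)
next
  case False
  then have "hom (finsupp_prod I C) u v = {}"
    by (auto simp: in_hom_finsupp_prod_iff)
  then show ?thesis
    by simp
qed

section \<open>Adding one factor\<close>

text \<open>The product argument, with the old product as first factor and \<open>C k\<close> as
  second. Finiteness in \<open>C k\<close> is assumed for all targets because it is applied to the
  object \<open>z\<close> that (P) supplies.\<close>

lemma fulfills_P_at2_finsupp_prod_upd:
  assumes C: "\<And>i. i \<in> I \<Longrightarrow> category (C i)"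
    and k: "k \<in> I" "k \<notin> dom u" "k \<notin> dom v"
    and Pu: "fulfills_P_at2 (finsupp_prod I C) (prod_functor \<delta>) u v"
    and Pk: "fulfills_P_at2 (C k) (\<delta> k) x y"
    and fin: "finite (hom (finsupp_prod I C) u v)"
      "\<And>z. z \<in> ob (C k) \<Longrightarrow> finite (hom (C k) x z)"
  shows "fulfills_P_at2 (finsupp_prod I C) (prod_functor \<delta>) (u(k \<mapsto> x)) (v(k \<mapsto> y))"
proof -
  define P where "P = finsupp_prod I C"
  define \<Delta> where "\<Delta> = prod_functor \<delta>"
  interpret P: category P
    unfolding P_def using C by (rule category_finsupp_prod)
  interpret Ck: category "C k"
    using C k(1) .
  have "fulfills_P_at2 P \<Delta> (u(k \<mapsto> x)) (v(k \<mapsto> y))"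
    unfolding fulfills_P_at2_def
  proof
    fix r :: nat
    \<comment> \<open>The object \<open>z\<close> must come first: the colorings for which
      \<open>w\<close> is chosen are indexed by the arrows from \<open>x\<close> to
      \<open>z\<close>.\<close>
    obtain z where z: "z \<in> ob (C k)" and
      Hk: "\<forall>(\<chi> :: _ \<Rightarrow> _ \<Rightarrow> nat) S. finite S \<longrightarrow> card S \<le> r \<longrightarrow>
        (\<forall>f \<in> hom P u v. \<forall>\<phi> \<in> hom (C k) x z. \<chi> f \<phi> \<in> S) \<longrightarrow>
        (\<exists>\<gamma> \<in> hom (C k) y z. \<forall>\<phi>\<^sub>1 \<in> hom (C k) x y. \<forall>\<phi>\<^sub>2 \<in> hom (C k) x y.
          arr_map (\<delta> k) \<phi>\<^sub>1 = arr_map (\<delta> k) \<phi>\<^sub>2 \<longrightarrow>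
          (\<forall>f \<in> hom P u v. \<chi> f (compos (C k) \<gamma> \<phi>\<^sub>1) = \<chi> f (compos (C k) \<gamma> \<phi>\<^sub>2)))"
      using Ck.fulfills_P_at2_simultaneous[OF Pk fin(1)[folded P_def], of r] by (elim bexE)
    obtain w where w: "w \<in> ob P" and
      Hu: "\<forall>(\<chi> :: _ \<Rightarrow> _ \<Rightarrow> nat) S. finite S \<longrightarrow> card S \<le> r \<longrightarrow>
        (\<forall>\<phi> \<in> hom (C k) x z. \<forall>f \<in> hom P u w. \<chi> \<phi> f \<in> S) \<longrightarrow>
        (\<exists>g \<in> hom P v w. \<forall>f\<^sub>1 \<in> hom P u v. \<forall>f\<^sub>2 \<in> hom P u v.
          arr_map \<Delta> f\<^sub>1 = arr_map \<Delta> f\<^sub>2 \<longrightarrow>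
          (\<forall>\<phi> \<in> hom (C k) x z. \<chi> \<phi> (compos P g f\<^sub>1) = \<chi> \<phi> (compos P g f\<^sub>2)))"
      using P.fulfills_P_at2_simultaneous[OF Pu[folded P_def \<Delta>_def] fin(2)[OF z], of r]
      by (elim bexE)
    show "\<exists>c \<in> ob P. \<forall>\<chi>. coloring r (hom P (u(k \<mapsto> x)) c) \<chi> \<longrightarrow>
      (\<exists>g \<in> hom P (v(k \<mapsto> y)) c. \<forall>f\<^sub>1 \<in> hom P (u(k \<mapsto> x)) (v(k \<mapsto> y)).
        \<forall>f\<^sub>2 \<in> hom P (u(k \<mapsto> x)) (v(k \<mapsto> y)).
          arr_map \<Delta> f\<^sub>1 = arr_map \<Delta> f\<^sub>2 \<longrightarrow> \<chi> (compos P g f\<^sub>1) = \<chi> (compos P g f\<^sub>2))"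
    proof (intro bexI[of _ "w(k \<mapsto> z)"] allI impI)
      show "w(k \<mapsto> z) \<in> ob P"
        using w z k(1) unfolding P_def by (auto simp: in_ob_finsupp_prod_iff)
      fix \<chi> assume col: "coloring r (hom P (u(k \<mapsto> x)) (w(k \<mapsto> z))) \<chi>"
      \<comment> \<open>The common palette: fixing either coordinate of a morphism turns
        \<open>\<chi>\<close> into a coloring with values in \<open>S\<close>.\<close>
      define S where "S = \<chi> ` hom P (u(k \<mapsto> x)) (w(k \<mapsto> z))"
      have S: "finite S" "card S \<le> r"
        using col unfolding coloring_def S_def by simp_all
      have \<chi>: "\<chi> (f(k \<mapsto> \<phi>)) \<in> S" if "f \<in> hom P u w" "\<phi> \<in> hom (C k) x z" for f \<phi>
        unfolding S_def P_def
        by (intro imageI upd_in_hom_finsupp_prod k(1) that(1)[unfolded P_def] that(2))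
      have "\<forall>\<phi> \<in> hom (C k) x z. \<forall>f \<in> hom P u w. \<chi> (f(k \<mapsto> \<phi>)) \<in> S"
        using \<chi> by blast
      from Hu[THEN spec, of "\<lambda>\<phi> f. \<chi> (f(k \<mapsto> \<phi>))",
          THEN spec, THEN mp, OF S(1), THEN mp, OF S(2), THEN mp, OF this]
      obtain g where g: "g \<in> hom P v w" and
        gu: "\<forall>f\<^sub>1 \<in> hom P u v. \<forall>f\<^sub>2 \<in> hom P u v. arr_map \<Delta> f\<^sub>1 = arr_map \<Delta> f\<^sub>2 \<longrightarrow>
          (\<forall>\<phi> \<in> hom (C k) x z. \<chi> ((compos P g f\<^sub>1)(k \<mapsto> \<phi>)) = \<chi> ((compos P g f\<^sub>2)(k \<mapsto> \<phi>)))"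
        by (elim bexE)
      \<comment> \<open>These colorings depend on \<open>g\<close>, but their index set and palette
        size are those for which \<open>z\<close> was chosen.\<close>
      have "\<forall>f \<in> hom P u v. \<forall>\<phi> \<in> hom (C k) x z. \<chi> ((compos P g f)(k \<mapsto> \<phi>)) \<in> S"
        using \<chi> P.comp_hom[OF _ g] by blast
      from Hk[THEN spec, of "\<lambda>f \<phi>. \<chi> ((compos P g f)(k \<mapsto> \<phi>))",
          THEN spec, THEN mp, OF S(1), THEN mp, OF S(2), THEN mp, OF this]
      obtain \<gamma> where \<gamma>: "\<gamma> \<in> hom (C k) y z" and
        gk: "\<forall>\<phi>\<^sub>1 \<in> hom (C k) x y. \<forall>\<phi>\<^sub>2 \<in> hom (C k) x y.
          arr_map (\<delta> k) \<phi>\<^sub>1 = arr_map (\<delta> k) \<phi>\<^sub>2 \<longrightarrow> (\<forall>f \<in> hom P u v.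
          \<chi> ((compos P g f)(k \<mapsto> compos (C k) \<gamma> \<phi>\<^sub>1)) = \<chi> ((compos P g f)(k \<mapsto> compos (C k) \<gamma> \<phi>\<^sub>2)))"
        by (elim bexE)
      show "\<exists>g \<in> hom P (v(k \<mapsto> y)) (w(k \<mapsto> z)). \<forall>f\<^sub>1 \<in> hom P (u(k \<mapsto> x)) (v(k \<mapsto> y)).
        \<forall>f\<^sub>2 \<in> hom P (u(k \<mapsto> x)) (v(k \<mapsto> y)).
          arr_map \<Delta> f\<^sub>1 = arr_map \<Delta> f\<^sub>2 \<longrightarrow> \<chi> (compos P g f\<^sub>1) = \<chi> (compos P g f\<^sub>2)"
      proof (intro bexI[of _ "g(k \<mapsto> \<gamma>)"] ballI impI)
        show "g(k \<mapsto> \<gamma>) \<in> hom P (v(k \<mapsto> y)) (w(k \<mapsto> z))"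
          using g \<gamma> k(1) unfolding P_def by (intro upd_in_hom_finsupp_prod)
        fix F\<^sub>1 F\<^sub>2
        assume F: "F\<^sub>1 \<in> hom P (u(k \<mapsto> x)) (v(k \<mapsto> y))" "F\<^sub>2 \<in> hom P (u(k \<mapsto> x)) (v(k \<mapsto> y))"
          and eq: "arr_map \<Delta> F\<^sub>1 = arr_map \<Delta> F\<^sub>2"
        obtain f\<^sub>1 \<phi>\<^sub>1 where 1: "F\<^sub>1 = f\<^sub>1(k \<mapsto> \<phi>\<^sub>1)" "f\<^sub>1 \<in> hom P u v" "\<phi>\<^sub>1 \<in> hom (C k) x y"
          using in_hom_finsupp_prod_updE[OF F(1)[unfolded P_def] k(2,3)] unfolding P_def .
        obtain f\<^sub>2 \<phi>\<^sub>2 where 2: "F\<^sub>2 = f\<^sub>2(k \<mapsto> \<phi>\<^sub>2)" "f\<^sub>2 \<in> hom P u v" "\<phi>\<^sub>2 \<in> hom (C k) x y"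
          using in_hom_finsupp_prod_updE[OF F(2)[unfolded P_def] k(2,3)] unfolding P_def .
        have "k \<notin> dom f\<^sub>1" "k \<notin> dom f\<^sub>2"
          using 1(2) 2(2) k(2) unfolding P_def by (auto dest: dom_eq_if_in_hom_finsupp_prod)
        then have e: "arr_map \<Delta> f\<^sub>1 = arr_map \<Delta> f\<^sub>2" "arr_map (\<delta> k) \<phi>\<^sub>1 = arr_map (\<delta> k) \<phi>\<^sub>2"
          using eq unfolding 1(1) 2(1) \<Delta>_def arr_map_prod_functor_upd by (simp_all add: map_upd_eq_iff)
        \<comment> \<open>The coordinates are exchanged one at a time: first
          \<open>f\<^sub>1\<close> for \<open>f\<^sub>2\<close> by the choice of \<open>g\<close>,
          then \<open>\<phi>\<^sub>1\<close> for \<open>\<phi>\<^sub>2\<close> by the choice of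
          \<open>\<gamma>\<close>.\<close>
        have "\<chi> ((compos P g f\<^sub>1)(k \<mapsto> compos (C k) \<gamma> \<phi>\<^sub>1)) =
            \<chi> ((compos P g f\<^sub>2)(k \<mapsto> compos (C k) \<gamma> \<phi>\<^sub>1))"
          by (intro gu[rule_format] 1(2) 2(2) e(1) Ck.comp_hom[OF 1(3) \<gamma>])
        also have "\<dots> = \<chi> ((compos P g f\<^sub>2)(k \<mapsto> compos (C k) \<gamma> \<phi>\<^sub>2))"
          by (intro gk[rule_format] 1(3) 2(2,3) e(2))
        finally show "\<chi> (compos P (g(k \<mapsto> \<gamma>)) F\<^sub>1) = \<chi> (compos P (g(k \<mapsto> \<gamma>)) F\<^sub>2)"
          unfolding 1(1) 2(1) P_def compos_finsupp_prod_upd .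
      qed
    qed
  qed
  then show ?thesis
    unfolding P_def \<Delta>_def .
qed

section \<open>Induction on the finite index set\<close>

theorem theorem9:
  fixes I K :: "'i set"
    and C :: "'i \<Rightarrow> ('o, 'm) category"
    and D :: "'i \<Rightarrow> ('p, 'n) category"
    and \<delta> :: "'i \<Rightarrow> ('o, 'm, 'p, 'n) functor_data"
    and a :: "'i \<Rightarrow> 'o"
  assumes "\<And>i. i \<in> I \<Longrightarrow> frank_functor (C i) (D i) (\<delta> i)"
    and "K \<subseteq> I" and "finite K"
    and "\<And>i x y. i \<in> K \<Longrightarrow> x \<in> ob (C i) \<Longrightarrow> y \<in> ob (C i) \<Longrightarrow> finite (hom (C i) x y)"
    and "\<And>i. i \<in> K \<Longrightarrow> a i \<in> ob (C i)"
    and "\<And>i. i \<in> K \<Longrightarrow> fulfills_P_at (C i) (\<delta> i) (a i)"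
  shows "fulfills_P_at (finsupp_prod I C) (prod_functor \<delta>) (family K a)"
  using assms(3,2,4-6)
proof (induction K)
  case empty
  interpret P: category "finsupp_prod I C"
    using assms(1) by (intro category_finsupp_prod) (simp add: frank_functor_def cat_functor_def)
  \<comment> \<open>Over the empty index set the empty family is the only possible morphism.\<close>
  have "f = Map.empty" if "f \<in> hom (finsupp_prod I C) (family {} a) b" for f b
    using dom_eq_if_in_hom_finsupp_prod[OF that] by (metis dom_family dom_eq_empty_conv)
  then have "f\<^sub>1 = f\<^sub>2" if "f\<^sub>1 \<in> hom (finsupp_prod I C) (family {} a) b"
    "f\<^sub>2 \<in> hom (finsupp_prod I C) (family {} a) b" for f\<^sub>1 f\<^sub>2 b
    using that by blast
  then show ?case
    unfolding fulfills_P_at_def by (blast intro: P.fulfills_P_at2_if_subsingleton)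
next
  case (insert k K)
  have C: "category (C i)" if "i \<in> I" for i
    using assms(1)[OF that] by (simp add: frank_functor_def cat_functor_def)
  interpret P: category "finsupp_prod I C"
    using C by (rule category_finsupp_prod)
  have family: "family (insert k K) a = (family K a)(k \<mapsto> a k)"
    by (auto simp: family_def)
  show ?case
    unfolding fulfills_P_at_def
  proof
    fix b assume b: "b \<in> ob (finsupp_prod I C)"
    show "fulfills_P_at2 (finsupp_prod I C) (prod_functor \<delta>) (family (insert k K) a) b"
    proof (cases "dom b = insert k K")
      case False
      \<comment> \<open>Morphisms preserve index sets, so only targets indexed by
        \<open>insert k K\<close> need the product argument.\<close>
      then have "hom (finsupp_prod I C) (family (insert k K) a) b = {}"
        by (metis dom_eq_if_in_hom_finsupp_prod dom_family ex_in_conv)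
      then show ?thesis
        using b by (intro P.fulfills_P_at2_if_subsingleton) auto
    next
      case True
      \<comment> \<open>The part of the target over \<open>K\<close>, to which the induction
        hypothesis applies.\<close>
      define v where "v = b(k := None)"
      have dom: "dom v = K"
        using True insert.hyps(2) by (auto simp: v_def)
      have b_eq: "b = v(k \<mapsto> the (b k))"
        using True by (force simp: v_def)
      have v: "v \<in> ob (finsupp_prod I C)" and bk: "the (b k) \<in> ob (C k)"
        using b True unfolding in_ob_finsupp_prod_iff v_def by auto
      have "fulfills_P_at (finsupp_prod I C) (prod_functor \<delta>) (family K a)"
        using insert.prems by (intro insert.IH) auto
      then have Pu: "fulfills_P_at2 (finsupp_prod I C) (prod_functor \<delta>) (family K a) v"
        using v by (simp add: fulfills_P_at_def)
      have Pk: "fulfills_P_at2 (C k) (\<delta> k) (a k) (the (b k))"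
        using insert.prems(4)[of k] bk by (simp add: fulfills_P_at_def)
      have "finite (hom (C i) (the (family K a i)) (the (v i)))" if "i \<in> K" for i
        using insert.prems(2,3) v dom that
        by (intro insert.prems(2)) (auto simp: family_def in_ob_finsupp_prod_iff)
      then have fin: "finite (hom (finsupp_prod I C) (family K a) v)"
        by (intro finite_hom_finsupp_prod) simp
      have k: "k \<in> I" "k \<notin> dom (family K a)" "k \<notin> dom v"
        using insert.prems(1) insert.hyps(2) dom by auto
      have "finite (hom (C k) (a k) z)" if "z \<in> ob (C k)" for z
        using that insert.prems(2,3) by blast
      from fulfills_P_at2_finsupp_prod_upd[OF C k Pu Pk fin this] show ?thesis
        unfolding family b_eq[symmetric] .
    qed
  qed
qed

end
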